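(* Let $B$ be an atomless Boolean contact algebra satisfying - the interpolation axiom: $x\ll y\Rightarrow \exists z\,(x\ll z\wedge z\ll y)$; - the connectedness axiom: $x\notin\{0,1\}\Rightarrow x\mathrel{C}-x$; - the countable chain condition: every set of elements of $B$ that are pairwise incompatible (pairwise meets equal to $0$) is at most countable; - axiom (G1): for every $x\in B$ with $x\neq 0$ there is a G-representative $Q$ with $x\in Q$; - axiom (G2): if $x\mathrel{C}y$, then there is a G-representative $Q$ such that $u\cdot x\neq 0$ and $u\cdot y\neq 0$ for all $u\in Q$. Then the topological space $\langle \mathbf{Grz}(B),\mathscr{O}\rangle$ of all G-points of $B$ satisfies $\mathbf{Grz}(B)=\mathbf{Grz}^\omega(B)$, and so it is a space whose points are W-points: every element of $\mathbf{Grz}(B)$ is of the form $\{y\in B\mid \exists x\in A\ x\leq y\}$ for some W-representative $A$ of $B$.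
   Context: A Boolean contact algebra is a Boolean algebra $B$ (operations $\cdot,+,-$, constants $0,1$, order $\leq$) with a binary relation $C$ (contact) such that for all $x,y,z\in B$: (C0) not $0\mathrel{C}x$; (C1) $x\leq y\wedge x\neq 0\Rightarrow x\mathrel{C}y$; (C2) $x\mathrel{C}y\Rightarrow y\mathrel{C}x$; (C3) $x\leq y\Rightarrow \forall z\,(z\mathrel{C}x\Rightarrow z\mathrel{C}y)$; (C4) $x\mathrel{C}(y+z)\Rightarrow x\mathrel{C}y\vee x\mathrel{C}z$. Non-tangential inclusion is defined by: $x\ll y$ iff not $x\mathrel{C}(-y)$. A G-representative (Grzegorczyk representative of a point) in $B$ is a non-empty set $Q\subseteq B$ such that: (r0) $0\notin Q$; (r1) for all $u,v\in Q$: $u=v$ or $u\ll v$ or $v\ll u$; (r2) for every $u\in Q$ there is $v\in Q$ with $v\ll u$; (r3) for all $x,y\in B$: if $u\cdot x\neq 0$ and $u\cdot y\neq 0$ for all $u\in Q$, then $x\mathrel{C}y$. A G-point (Grzegorczyk point) of $B$ is a filter generated by a G-representative $Q$, i.e. a set $\{y\in B\mid \exists x\in Q\ x\leq y\}$. The set of all G-points is $\mathbf{Grz}(B)$. It carries the topology $\mathscr{O}$ with basis consisting of the sets $\{\mathscr{G}\in\mathbf{Grz}(B)\mid x\in\mathscr{G}\}$, $x\in B$. An abstractive set in $B$ is a set $A\subseteq B$ satisfying (r0) and (r1) (with $A$ in place of $Q$) and having no minimum, i.e. there is no $x\in A$ with $x\leq y$ for all $y\in A$. For $A_1,A_2\subseteq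 B$, $A_1$ covers $A_2$ ($A_1\succeq A_2$) iff for every $x\in A_1$ there is $y\in A_2$ with $y\leq x$. Abstractive sets $A_1,A_2$ are similar, $A_1\sim A_2$, iff $A_1\succeq A_2$ and $A_2\succeq A_1$. Put $[A_1]\trianglerighteq[A_2]$ iff $A_1\succeq A_2$ (a partial order on $\sim$-classes). A W-point (Whitehead point) is a class $[A]$ such that for every abstractive $A'$, $[A]\trianglerighteq[A']$ implies $[A]=[A']$. A W-representative is an abstractive set $A$ such that $[A]$ is a W-point; equivalently, for every abstractive $A'$, $A\succeq A'$ implies $A'\succeq A$. Since two abstractive sets are similar iff they generate the same upward closed set, a W-point $[A]$ is identified with $\{y\in B\mid\exists x\in A\ x\leq y\}$, in the same way that G-points correspond to classes of G-representatives under mutual covering. $\mathbf{Grz}^\omega(B)$ is the set of those G-points generated by some G-representative $Q$ for which there is a countable abstractive set $A'$ with $Q\succeq A'$ and $A'\succeq Q$. The Axiom of Choice is assumed. *)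

theory Defs
  imports "HOL-Analysis.Analysis"
begin

text \<open>
  The Boolean algebra is a type of class \<^class>\<open>boolean_algebra\<close>; this class does not
  exclude the degenerate algebra with \<open>bot = top\<close>. The contact relation is a predicate on it.
\<close>

locale boolean_contact_algebra =
  fixes C :: "'a::boolean_algebra \<Rightarrow> 'a \<Rightarrow> bool"
  assumes C0: "\<not> C bot x"
    and C1: "x \<le> y \<and> x \<noteq> bot \<Longrightarrow> C x y"
    and C2: "C x y \<Longrightarrow> C y x"
    and C3: "x \<le> y \<Longrightarrow> \<forall>z. C z x \<longrightarrow> C z y"
    and C4: "C x (sup y z) \<Longrightarrow> C x y \<or> C x z"

definition nt_incl :: "('a::boolean_algebra \<Rightarrow> 'a \<Rightarrow> bool) \<Rightarrow> 'a \<Rightarrow> 'a \<Rightarrow> bool" where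
  "nt_incl C x y \<longleftrightarrow> \<not> C x (- y)"

definition atom :: "'a::boolean_algebra \<Rightarrow> bool" where
  "atom x \<longleftrightarrow> x \<noteq> bot \<and> (\<forall>y. y \<le> x \<longrightarrow> y = bot \<or> y = x)"

definition up_set :: "'a::boolean_algebra set \<Rightarrow> 'a set" where
  "up_set A = {y. \<exists>x\<in>A. x \<le> y}"

definition r0 :: "'a::boolean_algebra set \<Rightarrow> bool" where
  "r0 Q \<longleftrightarrow> bot \<notin> Q"

definition r1 :: "('a::boolean_algebra \<Rightarrow> 'a \<Rightarrow> bool) \<Rightarrow> 'a set \<Rightarrow> bool" where
  "r1 C Q \<longleftrightarrow> (\<forall>u\<in>Q. \<forall>v\<in>Q. u = v \<or> nt_incl C u v \<or> nt_incl C v u)"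

definition r2 :: "('a::boolean_algebra \<Rightarrow> 'a \<Rightarrow> bool) \<Rightarrow> 'a set \<Rightarrow> bool" where
  "r2 C Q \<longleftrightarrow> (\<forall>u\<in>Q. \<exists>v\<in>Q. nt_incl C v u)"

definition r3 :: "('a::boolean_algebra \<Rightarrow> 'a \<Rightarrow> bool) \<Rightarrow> 'a set \<Rightarrow> bool" where
  "r3 C Q \<longleftrightarrow> (\<forall>x y. (\<forall>u\<in>Q. inf u x \<noteq> bot \<and> inf u y \<noteq> bot) \<longrightarrow> C x y)"

definition G_representative :: "('a::boolean_algebra \<Rightarrow> 'a \<Rightarrow> bool) \<Rightarrow> 'a set \<Rightarrow> bool" where
  "G_representative C Q \<longleftrightarrow> Q \<noteq> {} \<and> r0 Q \<and> r1 C Q \<and> r2 C Q \<and> r3 C Q"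

definition Grz :: "('a::boolean_algebra \<Rightarrow> 'a \<Rightarrow> bool) \<Rightarrow> 'a set set" where
  "Grz C = {up_set Q |Q. G_representative C Q}"

definition Grz_base :: "('a::boolean_algebra \<Rightarrow> 'a \<Rightarrow> bool) \<Rightarrow> 'a set set set" where
  "Grz_base C = {{G \<in> Grz C. x \<in> G} |x. True}"

definition Grz_space :: "('a::boolean_algebra \<Rightarrow> 'a \<Rightarrow> bool) \<Rightarrow> 'a set topology" where
  "Grz_space C = topology (arbitrary union_of (\<lambda>U. U \<in> Grz_base C))"

text \<open>
  Nonemptiness is not required below, so the empty set is abstractive. It covers every set and
  is covered by no nonempty one.
\<close>

definition abstractive :: "('a::boolean_algebra \<Rightarrow> 'a \<Rightarrow> bool) \<Rightarrow> 'a set \<Rightarrow> bool" where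
  "abstractive C A \<longleftrightarrow> r0 A \<and> r1 C A \<and> \<not> (\<exists>x\<in>A. \<forall>y\<in>A. x \<le> y)"

definition covers :: "'a::boolean_algebra set \<Rightarrow> 'a set \<Rightarrow> bool" where
  "covers A1 A2 \<longleftrightarrow> (\<forall>x\<in>A1. \<exists>y\<in>A2. y \<le> x)"

definition similarity :: "('a::boolean_algebra \<Rightarrow> 'a \<Rightarrow> bool) \<Rightarrow> ('a set \<times> 'a set) set" where
  "similarity C =
     {(A1, A2). abstractive C A1 \<and> abstractive C A2 \<and> covers A1 A2 \<and> covers A2 A1}"

definition class_covers :: "'a::boolean_algebra set set \<Rightarrow> 'a set set \<Rightarrow> bool" where
  "class_covers X Y \<longleftrightarrow> (\<exists>A1\<in>X. \<exists>A2\<in>Y. covers A1 A2)"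

definition W_points :: "('a::boolean_algebra \<Rightarrow> 'a \<Rightarrow> bool) \<Rightarrow> 'a set set set" where
  "W_points C = {X \<in> Collect (abstractive C) // similarity C.
     \<forall>Y \<in> Collect (abstractive C) // similarity C. class_covers X Y \<longrightarrow> X = Y}"

definition W_representative :: "('a::boolean_algebra \<Rightarrow> 'a \<Rightarrow> bool) \<Rightarrow> 'a set \<Rightarrow> bool" where
  "W_representative C A \<longleftrightarrow> abstractive C A \<and> similarity C `` {A} \<in> W_points C"

definition Grz_omega :: "('a::boolean_algebra \<Rightarrow> 'a \<Rightarrow> bool) \<Rightarrow> 'a set set" where
  "Grz_omega C = {up_set Q |Q. G_representative C Q \<and>
     (\<exists>A'. countable A' \<and> abstractive C A' \<and> covers Q A' \<and> covers A' Q)}"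

lemma covers_refl: "covers A A"
  unfolding covers_def by blast

lemma covers_trans: "covers A1 A2 \<Longrightarrow> covers A2 A3 \<Longrightarrow> covers A1 A3"
  unfolding covers_def by (meson order_trans)

lemma equiv_similarity: "equiv (Collect (abstractive C)) (similarity C)"
proof (rule equivI)
  show "similarity C \<subseteq> Collect (abstractive C) \<times> Collect (abstractive C)"
    by (auto simp: similarity_def)
  show "refl_on (Collect (abstractive C)) (similarity C)"
    by (auto simp: refl_on_def similarity_def covers_refl)
  show "sym (similarity C)"
    by (auto simp: sym_def similarity_def)
  show "trans (similarity C)"
    unfolding trans_def similarity_def by (auto intro: covers_trans)
qed

lemma similar_iff_up_set_eq:
  assumes "abstractive C A1" "abstractive C A2"
  shows "(A1, A2) \<in> similarity C \<longleftrightarrow> up_set A1 = up_set A2"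
proof -
  have "covers A B \<longleftrightarrow> up_set A \<subseteq> up_set B" for A B :: "'a set"
    unfolding covers_def up_set_def by (auto intro: order_trans)
  with assms show ?thesis
    unfolding similarity_def by auto
qed

lemma class_covers_iff:
  assumes "abstractive C A1" "abstractive C A2"
  shows "class_covers (similarity C `` {A1}) (similarity C `` {A2}) \<longleftrightarrow> covers A1 A2"
proof
  assume "class_covers (similarity C `` {A1}) (similarity C `` {A2})"
  then show "covers A1 A2"
    unfolding class_covers_def similarity_def by (auto intro: covers_trans)
next
  assume "covers A1 A2"
  with assms show "class_covers (similarity C `` {A1}) (similarity C `` {A2})"
    unfolding class_covers_def similarity_def using covers_refl by blast
qed

lemma W_representative_iff:
  "W_representative C A \<longleftrightarrow>
     abstractive C A \<and> (\<forall>A'. abstractive C A' \<longrightarrow> covers A A' \<longrightarrow> covers A' A)"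
proof (cases "abstractive C A")
  case True
  have eq: "similarity C `` {A} = similarity C `` {A'} \<longleftrightarrow> covers A A' \<and> covers A' A"
    if "abstractive C A'" for A'
    using eq_equiv_class_iff[OF equiv_similarity[of C], of A A'] True that
    by (simp add: similarity_def)
  have "W_representative C A \<longleftrightarrow> (\<forall>A'. abstractive C A' \<longrightarrow>
      class_covers (similarity C `` {A}) (similarity C `` {A'}) \<longrightarrow>
      similarity C `` {A} = similarity C `` {A'})"
    using True unfolding W_representative_def W_points_def quotient_def by auto
  also have "\<dots> \<longleftrightarrow> (\<forall>A'. abstractive C A' \<longrightarrow> covers A A' \<longrightarrow> covers A' A)"
    using True eq class_covers_iff by blast
  finally show ?thesis using True by simp
qed (simp add: W_representative_def)

context boolean_contact_algebra
begin

lemma nt_incl_imp_le: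
  assumes "nt_incl C x y" shows "x \<le> y"
proof (rule ccontr)
  assume "\<not> x \<le> y"
  then have ne: "inf x (- y) \<noteq> bot"
    by (simp add: inf_shunt)
  have "C (inf x (- y)) x"
    using C1 ne by simp
  then have "C x (inf x (- y))"
    by (rule C2)
  then have "C x (- y)"
    using C3[of "inf x (- y)" "- y"] by simp
  with assms show False
    by (simp add: nt_incl_def)
qed

lemma Grz_inf:
  assumes "G \<in> Grz C" shows "inf x y \<in> G \<longleftrightarrow> x \<in> G \<and> y \<in> G"
proof -
  obtain Q where Q: "r1 C Q" "G = up_set Q"
    using assms unfolding Grz_def G_representative_def by blast
  have chain: "u \<le> v \<or> v \<le> u" if "u \<in> Q" "v \<in> Q" for u v
    using Q(1) that nt_incl_imp_le unfolding r1_def by (metis order_refl)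
  show ?thesis
    unfolding Q(2) up_set_def
  proof safe
    fix u v assume "u \<in> Q" "u \<le> x" "v \<in> Q" "v \<le> y"
    then show "\<exists>w\<in>Q. w \<le> inf x y"
      using chain[of u v] by (auto intro: order_trans)
  qed auto
qed

lemma openin_Grz_space: "openin (Grz_space C) = arbitrary union_of (\<lambda>U. U \<in> Grz_base C)"
proof -
  have "S \<inter> T \<in> Grz_base C" if ST: "S \<in> Grz_base C" "T \<in> Grz_base C" for S T
  proof -
    obtain x y where "S = {G \<in> Grz C. x \<in> G}" "T = {G \<in> Grz C. y \<in> G}"
      using ST unfolding Grz_base_def by blast
    then have "S \<inter> T = {G \<in> Grz C. inf x y \<in> G}"
      using Grz_inf by auto
    then show ?thesis
      unfolding Grz_base_def by blast
  qed
  then show ?thesis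
    unfolding Grz_space_def by (simp add: istopology_base topology_inverse')
qed

lemma topspace_Grz_space: "topspace (Grz_space C) = Grz C"
proof
  have "U \<subseteq> Grz C" if "openin (Grz_space C) U" for U
    using that unfolding openin_Grz_space union_of_def Grz_base_def by blast
  then show "topspace (Grz_space C) \<subseteq> Grz C"
    by simp
  have "top \<in> G" if "G \<in> Grz C" for G
    using that unfolding Grz_def G_representative_def up_set_def by auto
  then have "Grz C = {G \<in> Grz C. top \<in> G}"
    by blast
  then have "Grz C \<in> Grz_base C"
    unfolding Grz_base_def by blast
  then have "openin (Grz_space C) (Grz C)"
    unfolding openin_Grz_space by (simp add: arbitrary_def union_of_inc)
  then show "Grz C \<subseteq> topspace (Grz_space C)"
    by (rule openin_subset)
qed

end

end

theory Submission
  imports Defs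
begin

text \<open>
  A G-representative \<open>Q\<close> is a descending chain. It has no least element: by (r2) a least element
  would be non-tangentially included in itself, so by connectedness it would be \<open>1\<close>, and (r3)
  together with (G1) excludes \<open>Q = {1}\<close> in an atomless algebra (\<open>G_representative_no_min\<close>).
  Hence \<open>Q\<close> is an abstractive set.

  Both claims follow. A chain without least element has a countable coinitial subset, because
  otherwise the differences between consecutive members of a coinitial descending sequence would
  supply uncountably many disjoint nonzero elements (\<open>ccc_chain_countable_coinitial\<close>). And \<open>Q\<close>
  is minimal for covering among abstractive sets, because (r3) leaves no room for a strictly
  smaller one (\<open>G_representative_covers_minimal\<close>). So \<open>Q\<close> is itself a W-representative of the
  G-point that it generates.
\<close>

text \<open>
  Call \<open>u - v\<close> with \<open>v < u\<close> in the chain a gap. The lower ends \<open>v\<close> of a maximal family of disjoint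
  gaps are coinitial: a member \<open>w\<close> of the chain below all of them would begin a further gap
  disjoint from the family. A maximal family is used in place of a transfinite descending sequence,
  so that ordinals are avoided.
\<close>

lemma ccc_chain_countable_coinitial:
  fixes Q :: "'a::boolean_algebra set"
  assumes ccc: "\<And>S :: 'a set. pairwise (\<lambda>x y. inf x y = bot) S \<Longrightarrow> countable S"
    and chain: "\<And>u v. u \<in> Q \<Longrightarrow> v \<in> Q \<Longrightarrow> u \<le> v \<or> v \<le> u"
    and no_min: "\<not> (\<exists>x\<in>Q. \<forall>y\<in>Q. x \<le> y)"
  obtains V where "countable V" "V \<subseteq> Q" "covers Q V"
proof -
  let ?disj = "pairwise (\<lambda>x y :: 'a. inf x y = bot)"
  define gaps where "gaps = {inf u (- v) |u v. u \<in> Q \<and> v \<in> Q \<and> v < u}"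
  define F where "F = {S. S \<subseteq> gaps \<and> ?disj S}"
  have "\<Union>K \<in> F" if "subset.chain F K" for K
  proof -
    have "chain\<^sub>\<subseteq> K"
      using that unfolding subset_chain_def chain_subset_def by blast
    moreover have "\<And>S. S \<in> K \<Longrightarrow> S \<subseteq> gaps \<and> ?disj S"
      using that unfolding F_def subset_chain_def by blast
    ultimately show ?thesis
      using pairwise_chain_Union[of K] unfolding F_def by blast
  qed
  then obtain S where S: "S \<in> F" and max: "\<And>T. T \<in> F \<Longrightarrow> S \<subseteq> T \<Longrightarrow> T = S"
    using subset_Zorn'[of F] by blast
  have "\<forall>s\<in>S. \<exists>v\<in>Q. \<exists>u\<in>Q. v < u \<and> s = inf u (- v)"
    using S unfolding F_def gaps_def by blast
  then obtain low where low: "\<And>s. s \<in> S \<Longrightarrow> low s \<in> Q \<and> (\<exists>u\<in>Q. s = inf u (- low s))"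
    by metis
  have "countable (low ` S)"
    using S ccc unfolding F_def by blast
  moreover have "low ` S \<subseteq> Q"
    using low by blast
  moreover have "covers Q (low ` S)"
    unfolding covers_def
  proof (rule ballI, rule ccontr)
    fix w assume w: "w \<in> Q" and "\<not> (\<exists>v\<in>low ` S. v \<le> w)"
    then have below: "w \<le> low s" if "s \<in> S" for s
      using that chain low by blast
    obtain w' where w': "w' \<in> Q" "w' < w"
      using no_min w chain unfolding less_le_not_le by blast
    let ?g = "inf w (- w')"
    have ne: "?g \<noteq> bot"
      using w' by (simp add: inf_shunt leD)
    have disj: "inf ?g s = bot" if s: "s \<in> S" for s
    proof -
      obtain u where "s = inf u (- low s)"
        using low[OF s] by blast
      then have "s \<le> - low s"
        by (metis inf_le2)
      then have "inf ?g s \<le> low s" "inf ?g s \<le> - low s"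
        using below[OF s] by (auto intro: le_infI1 le_infI2)
      then have "inf ?g s \<le> inf (low s) (- low s)"
        by (rule le_infI)
      then show ?thesis
        by (simp add: bot.extremum_unique)
    qed
    have "?g \<in> gaps"
      using w w' unfolding gaps_def by blast
    moreover have "?disj (insert ?g S)"
      using S disj unfolding F_def pairwise_insert by (auto simp: inf.commute[of _ ?g])
    ultimately have "insert ?g S \<in> F"
      using S unfolding F_def by blast
    then have "?g \<in> S"
      using max by blast
    then show False
      using disj[of ?g] ne by simp
  qed
  ultimately show thesis
    by (rule that)
qed

context boolean_contact_algebra
begin

lemma r1_imp_chain:
  assumes "r1 C Q" "u \<in> Q" "v \<in> Q"
  shows "u \<le> v \<or> v \<le> u"
proof -
  have "u = v \<or> nt_incl C u v \<or> nt_incl C v u"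
    using assms unfolding r1_def by blast
  then show ?thesis
    by (auto dest: nt_incl_imp_le)
qed

text \<open>
  The set \<open>{1}\<close> satisfies (r3) only if any two nonzero elements touch. An atomless algebra with
  \<open>0 \<noteq> 1\<close> contains some \<open>x\<close> other than \<open>0\<close> and \<open>1\<close>, and (G1) with (r2) gives a nonzero element
  that does not touch the nonzero element \<open>- x\<close>.
\<close>

lemma G_representative_no_min:
  assumes atomless: "\<not> (\<exists>x::'a. atom x)"
    and connectedness: "\<And>x. x \<notin> {bot, top} \<Longrightarrow> C x (- x)"
    and G1: "\<And>x. x \<noteq> bot \<Longrightarrow> \<exists>Q. G_representative C Q \<and> x \<in> Q"
    and Q: "G_representative C Q"
  shows "\<not> (\<exists>m\<in>Q. \<forall>y\<in>Q. m \<le> y)"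
proof
  assume "\<exists>m\<in>Q. \<forall>y\<in>Q. m \<le> y"
  then obtain m where m: "m \<in> Q" "\<And>y. y \<in> Q \<Longrightarrow> m \<le> y"
    by blast
  have Q': "r0 Q" "r2 C Q" "r3 C Q"
    using Q unfolding G_representative_def by auto
  obtain v where "v \<in> Q" "nt_incl C v m"
    using Q' m unfolding r2_def by blast
  then have "nt_incl C m m"
    using m nt_incl_imp_le by (metis order.antisym)
  moreover have "m \<noteq> bot"
    using Q'(1) m(1) unfolding r0_def by blast
  ultimately have top: "m = top" "(top::'a) \<noteq> bot"
    using connectedness[of m] unfolding nt_incl_def by auto
  have "inf u z \<noteq> bot" if "u \<in> Q" "z \<noteq> bot" for u z
    using m(2)[OF that(1)] that(2) unfolding top(1) by (simp add: top_unique)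
  then have touch: "C x y" if "x \<noteq> bot" "y \<noteq> bot" for x y
    using Q'(3) that unfolding r3_def by blast
  obtain x :: 'a where x: "x \<noteq> bot" "x \<noteq> top"
    using atomless top(2) unfolding atom_def by blast
  obtain P where P: "r0 P" "r2 C P" "x \<in> P"
    using G1[OF x(1)] unfolding G_representative_def by blast
  obtain p where "p \<in> P" "nt_incl C p x"
    using P unfolding r2_def by blast
  moreover from this have "p \<noteq> bot"
    using P(1) unfolding r0_def by blast
  moreover have "- x \<noteq> bot"
    using x(2) by (metis compl_bot_eq double_compl)
  ultimately show False
    using touch[of p "- x"] unfolding nt_incl_def by blast
qed

text \<open>
  Suppose \<open>a \<in> A\<close> lies above no member of \<open>Q\<close>, so that \<open>- a\<close> meets all of them. Since \<open>a\<close> is not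
  least in \<open>A\<close>, some \<open>b \<in> A\<close> satisfies \<open>b \<lless> a\<close>. Every member of \<open>Q\<close> lies above a member of the
  chain \<open>A\<close> and therefore meets \<open>b\<close>, so (r3) puts \<open>b\<close> in contact with \<open>- a\<close>, a contradiction.
\<close>

lemma G_representative_covers_minimal:
  assumes Q: "G_representative C Q" and A: "abstractive C A" and "covers Q A"
  shows "covers A Q"
  unfolding covers_def
proof (rule ballI, rule ccontr)
  fix a assume a: "a \<in> A" and "\<not> (\<exists>q\<in>Q. q \<le> a)"
  then have outside: "inf q (- a) \<noteq> bot" if "q \<in> Q" for q
    using that by (auto simp: inf_shunt)
  have A': "r0 A" "r1 C A" "\<not> (\<exists>x\<in>A. \<forall>y\<in>A. x \<le> y)"
    using A unfolding abstractive_def by auto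
  then obtain b where b: "b \<in> A" "\<not> a \<le> b"
    using a by blast
  then have "a \<noteq> b" "\<not> nt_incl C a b"
    using nt_incl_imp_le by auto
  then have "nt_incl C b a"
    using A'(2) a b(1) unfolding r1_def by blast
  moreover have "inf q b \<noteq> bot" if q: "q \<in> Q" for q
  proof -
    obtain y where y: "y \<in> A" "y \<le> q"
      using \<open>covers Q A\<close> q unfolding covers_def by blast
    have "y \<le> b \<or> b \<le> y"
      using r1_imp_chain[OF A'(2)] b(1) y(1) by blast
    then have "y \<le> inf q b \<or> b \<le> inf q b"
      using y by auto
    moreover have "y \<noteq> bot" "b \<noteq> bot"
      using A'(1) b y unfolding r0_def by auto
    ultimately show ?thesis
      using le_bot by metis
  qed
  then have "C b (- a)"
    using Q outside unfolding G_representative_def r3_def by blast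
  ultimately show False
    unfolding nt_incl_def by blast
qed

text \<open>
  Passing to a coinitial subset of a chain creates no least element, since that would be least in
  the whole chain as well.
\<close>

lemma abstractive_coinitial_subset:
  assumes "abstractive C A" "V \<subseteq> A" "covers A V"
  shows "abstractive C V"
proof -
  have "\<not> (\<exists>x\<in>V. \<forall>y\<in>V. x \<le> y)"
  proof
    assume "\<exists>x\<in>V. \<forall>y\<in>V. x \<le> y"
    then obtain x where x: "x \<in> V" "\<And>y. y \<in> V \<Longrightarrow> x \<le> y"
      by blast
    have "x \<le> y" if y: "y \<in> A" for y
    proof -
      obtain v where "v \<in> V" "v \<le> y"
        using assms(3) y unfolding covers_def by blast
      then show ?thesis
        using x(2) by (blast intro: order_trans)
    qed
    then show False
      using assms(1,2) x(1) unfolding abstractive_def by blast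
  qed
  moreover have "r0 V"
    using assms(1,2) unfolding abstractive_def r0_def by blast
  moreover have "r1 C V"
    using assms(1,2) unfolding abstractive_def r1_def by (simp add: subset_iff)
  ultimately show ?thesis
    unfolding abstractive_def by simp
qed

end

theorem theorem4:
  fixes C :: "'a::boolean_algebra \<Rightarrow> 'a \<Rightarrow> bool"
  assumes "boolean_contact_algebra C"
    and atomless: "\<not> (\<exists>x::'a. atom x)"
    and interpolation: "\<And>x y. nt_incl C x y \<Longrightarrow> \<exists>z. nt_incl C x z \<and> nt_incl C z y"
    and connectedness: "\<And>x. x \<notin> {bot, top} \<Longrightarrow> C x (- x)"
    and ccc: "\<And>S :: 'a set. pairwise (\<lambda>x y. inf x y = bot) S \<Longrightarrow> countable S"
    and G1: "\<And>x. x \<noteq> bot \<Longrightarrow> \<exists>Q. G_representative C Q \<and> x \<in> Q"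
    and G2: "\<And>x y. C x y \<Longrightarrow>
      \<exists>Q. G_representative C Q \<and> (\<forall>u\<in>Q. inf u x \<noteq> bot \<and> inf u y \<noteq> bot)"
  shows "topspace (Grz_space C) = Grz C \<and> Grz C = Grz_omega C \<and>
    (\<forall>G \<in> topspace (Grz_space C). \<exists>A. W_representative C A \<and> G = up_set A)"
proof -
  interpret boolean_contact_algebra C by fact
  have abs: "abstractive C Q" if "G_representative C Q" for Q
    using G_representative_no_min[OF atomless connectedness G1 that] that
    unfolding abstractive_def G_representative_def by simp
  have omega: "\<exists>A'. countable A' \<and> abstractive C A' \<and> covers Q A' \<and> covers A' Q"
    if Q: "G_representative C Q" for Q
  proof -
    have Q': "r1 C Q" "\<not> (\<exists>x\<in>Q. \<forall>y\<in>Q. x \<le> y)"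
      using abs[OF Q] unfolding abstractive_def by auto
    obtain V where V: "countable V" "V \<subseteq> Q" "covers Q V"
      by (rule ccc_chain_countable_coinitial[OF ccc r1_imp_chain[OF Q'(1)] Q'(2)])
    moreover have "covers V Q"
      using V(2) unfolding covers_def by blast
    ultimately show ?thesis
      using abstractive_coinitial_subset[OF abs[OF Q]] by blast
  qed
  have "Grz C = Grz_omega C"
    unfolding Grz_def Grz_omega_def using omega by blast
  moreover have "\<exists>A. W_representative C A \<and> G = up_set A" if G: "G \<in> Grz C" for G
  proof -
    obtain Q where Q: "G_representative C Q" "G = up_set Q"
      using G unfolding Grz_def by blast
    have "W_representative C Q"
      using abs[OF Q(1)] G_representative_covers_minimal[OF Q(1)]
      unfolding W_representative_iff by simp
    with Q(2) show ?thesis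
      by blast
  qed
  ultimately show ?thesis
    by (simp add: topspace_Grz_space)
qed

end
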